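(* Let $X\subseteq\mathbb{R}^n$ be a polyhedral set. The set of d-stationary values $\psi\left(\mathcal{D}_{(\psi,X)}\right)$ is finite if any one of the following three conditions holds: (a) $\psi$ is a piecewise linear-quadratic function on $X$; (b) $\psi$ is given by $\psi(x)=\psi_1(x)-\max_{1\le i\le k_2}\psi_{2i}(x)$, where $\psi_1$ is convex and $\psi_{2i}$ is concave for every $i=1,\ldots,k_2$; (c) $\psi(x)=\psi_1(x)+\psi_2(x)$ with $\psi_1$ a convex function and $\psi_2$ a piecewise affine function.
   Context: A polyhedral set is a set of the form $\{x\in\mathbb{R}^n : Ax\le b\}$. A quadratic function is a polynomial of degree at most two (its Hessian may be indefinite or zero). Directional derivative: $\psi'(\bar x;v)=\lim_{\delta\downarrow 0}\frac{\psi(\bar x+\delta v)-\psi(\bar x)}{\delta}$. A point $\bar x\in X$ is a d-stationary point of the program $\min_{x\in X}\psi(x)$ if $\psi'(\bar x;x-\bar x)\ge 0$ for all $x\in X$. $\mathcal{D}_{(\psi,X)}$ denotes the set of all d-stationary points of $\psi$ on $X$, and a d-stationary value is a number $\psi(\bar x)$ with $\bar x\in\mathcal{D}_{(\psi,X)}$ (the set may be empty). A continuous function $\psi:\mathbb{R}^n\to\mathbb{R}$ is piecewise affine if there exist finitely many affine functions $\psi_1,\ldots,\psi_k$ such that $\psi(x)\in\{\psi_1(x),\ldots,\psi_k(x)\}$ for all $x$. A continuous function is piecewise linear-quadratic on $X$ if $X$ is the union of finitely many polyhedral sets on each of which the function coincides with a quadratic function. In (b) and (c), all functions are real-valued and defined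 on an open convex set $\Omega\subseteq\mathbb{R}^n$ containing $X$ (piecewise affine functions being defined on all of $\mathbb{R}^n$); convexity and concavity are understood on $\Omega$. *)

theory Defs
  imports "HOL-Analysis.Analysis"
begin

definition has_dir_derivative ::
    "('a::real_normed_vector \<Rightarrow> real) \<Rightarrow> real \<Rightarrow> 'a \<Rightarrow> 'a \<Rightarrow> bool" where
  "has_dir_derivative \<psi> d x v \<longleftrightarrow>
     ((\<lambda>\<delta>::real. (\<psi> (x + \<delta> *\<^sub>R v) - \<psi> x) / \<delta>) \<longlongrightarrow> d) (at_right 0)"

(* Stationarity includes the existence of the directional derivatives. Since X is convex in all
   uses, only the values of \<psi> on X matter: x + \<delta> *\<^sub>R (y - x) lies in X for 0 < \<delta> \<le> 1. *)
definition d_stationary_points ::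
    "('a::real_normed_vector \<Rightarrow> real) \<Rightarrow> 'a set \<Rightarrow> 'a set" where
  "d_stationary_points \<psi> X =
     {x \<in> X. \<forall>y\<in>X. \<exists>d. has_dir_derivative \<psi> d x (y - x) \<and> d \<ge> 0}"

definition affine_function :: "(real ^ 'n \<Rightarrow> real) \<Rightarrow> bool" where
  "affine_function f \<longleftrightarrow> (\<exists>a c. \<forall>x. f x = a \<bullet> x + c)"

(* Q ranges over all square matrices, including indefinite ones and 0. *)
definition quadratic_function :: "(real ^ 'n \<Rightarrow> real) \<Rightarrow> bool" where
  "quadratic_function q \<longleftrightarrow>
     (\<exists>(Q :: real ^ 'n ^ 'n) a c. \<forall>x. q x = x \<bullet> (Q *v x) + a \<bullet> x + c)"

definition piecewise_affine :: "(real ^ 'n \<Rightarrow> real) \<Rightarrow> bool" where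
  "piecewise_affine \<psi> \<longleftrightarrow> continuous_on UNIV \<psi> \<and>
     (\<exists>F. finite F \<and> (\<forall>f\<in>F. affine_function f) \<and> (\<forall>x. \<psi> x \<in> (\<lambda>f. f x) ` F))"

definition piecewise_linear_quadratic_on ::
    "(real ^ 'n) set \<Rightarrow> (real ^ 'n \<Rightarrow> real) \<Rightarrow> bool" where
  "piecewise_linear_quadratic_on X \<psi> \<longleftrightarrow> continuous_on X \<psi> \<and>
     (\<exists>\<P>. finite \<P> \<and> X = \<Union>\<P> \<and>
       (\<forall>P\<in>\<P>. polyhedron P \<and> (\<exists>q. quadratic_function q \<and> (\<forall>x\<in>P. \<psi> x = q x))))"

end

theory Submission
  imports Defs
begin

text \<open>
  In each case the stationary points are covered by finitely many sets on each of which \<open>\<psi>\<close>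
  takes a single stationary value.

  For a pointwise minimum of convex functions \<open>g\<^sub>i\<close>, which is the form of a convex function
  minus a maximum of concave ones, the sets are indexed by an active piece. If \<open>g\<^sub>i\<close> is active at
  the stationary point \<open>x\<close>, then \<open>g\<^sub>i\<close> lies above \<open>\<psi>\<close> and touches it at \<open>x\<close>, so its slopes at \<open>x\<close>
  are nonnegative as well; being convex, \<open>g\<^sub>i\<close> is minimal over \<open>X\<close> at \<open>x\<close>
  (\<open>stationary_le_convex_majorant\<close>). Hence \<open>\<psi> x\<close> can only be the minimum of some \<open>g\<^sub>i\<close> over \<open>X\<close>.

  For a convex plus a piecewise affine function, space is cut into the cells on which the
  affine pieces are ordered in one and the same way. Cells are convex, and on a cell two pieces
  either agree everywhere or nowhere, so by connectedness the continuous selection is one of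
  the pieces there (\<open>continuous_selection_on_order_cell\<close>). Thus \<open>\<psi>\<close> is convex on the cell, and its
  stationary points in the cell are all minimizers over the cell.

  For a piecewise linear-quadratic function the sets are the relative interiors of the faces of
  the polyhedral pieces. Let \<open>x\<close> and \<open>y\<close> be stationary points in one of them. The segment
  between them can be prolonged beyond both ends inside the face, so stationarity applies in both
  directions at both ends. The quadratic therefore has zero slope at two points of the line
  through \<open>x\<close> and \<open>y\<close>, and so it is constant on that line.
\<close>

section \<open>Stationary points and one-sided slopes\<close>

lemma d_stationary_points_dest:
  assumes "x \<in> d_stationary_points \<psi> X" and "y \<in> X"
  obtains d where "d \<ge> 0"
    and "((\<lambda>\<delta>. (\<psi> (x + \<delta> *\<^sub>R (y - x)) - \<psi> x) / \<delta>) \<longlongrightarrow> d) (at_right 0)"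
  using assms unfolding d_stationary_points_def has_dir_derivative_def by blast

lemma d_stationary_points_subset: "d_stationary_points \<psi> X \<subseteq> X"
  by (auto simp: d_stationary_points_def)

lemma eventually_at_right_0_le_1: "eventually (\<lambda>\<delta>::real. 0 < \<delta> \<and> \<delta> \<le> 1) (at_right 0)"
  unfolding eventually_at_right_field by (rule exI[of _ 1]) auto

lemma finite_image_if_finite_cover:
  assumes "finite I" and "D \<subseteq> (\<Union>i\<in>I. C i)"
    and "\<And>i x y. i \<in> I \<Longrightarrow> x \<in> D \<inter> C i \<Longrightarrow> y \<in> D \<inter> C i \<Longrightarrow> f x = f y"
  shows "finite (f ` D)"
proof -
  have "finite (f ` (D \<inter> C i))" if "i \<in> I" for i
  proof (cases "D \<inter> C i = {}")
    case False
    then obtain z where "z \<in> D \<inter> C i" by blast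
    with assms(3)[OF that] have "f ` (D \<inter> C i) \<subseteq> {f z}" by blast
    then show ?thesis by (rule finite_subset) simp
  qed simp
  with \<open>finite I\<close> have "finite (\<Union>i\<in>I. f ` (D \<inter> C i))" by blast
  moreover have "f ` D \<subseteq> (\<Union>i\<in>I. f ` (D \<inter> C i))" using assms(2) by blast
  ultimately show ?thesis by (rule rev_finite_subset)
qed

text \<open>
  The difference quotients of \<open>\<psi>\<close> at \<open>x\<close> towards \<open>y\<close> lie below those of \<open>g\<close>, because the two
  functions agree at \<open>x\<close>, and the latter lie below \<open>g y - g x\<close> by convexity.
\<close>

lemma stationary_le_convex_majorant:
  fixes g :: "'a::real_normed_vector \<Rightarrow> real"
  assumes x: "x \<in> d_stationary_points \<psi> X" and y: "y \<in> X"
    and g: "convex_on S g" and "x \<in> S" "y \<in> S"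
    and le: "\<And>z. z \<in> S \<Longrightarrow> \<psi> z \<le> g z" and eq: "\<psi> x = g x"
  shows "g x \<le> g y"
proof -
  obtain d where "d \<ge> 0"
    and d: "((\<lambda>\<delta>. (\<psi> (x + \<delta> *\<^sub>R (y - x)) - \<psi> x) / \<delta>) \<longlongrightarrow> d) (at_right 0)"
    using d_stationary_points_dest[OF x y] .
  have "eventually (\<lambda>\<delta>. (\<psi> (x + \<delta> *\<^sub>R (y - x)) - \<psi> x) / \<delta> \<le> g y - g x) (at_right 0)"
    using eventually_at_right_0_le_1
  proof (rule eventually_mono)
    fix \<delta> :: real
    assume \<delta>: "0 < \<delta> \<and> \<delta> \<le> 1"
    have comb: "x + \<delta> *\<^sub>R (y - x) = (1 - \<delta>) *\<^sub>R x + \<delta> *\<^sub>R y"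
      by (simp add: algebra_simps)
    have "x + \<delta> *\<^sub>R (y - x) \<in> S"
      unfolding comb using convex_on_imp_convex[OF g] \<open>x \<in> S\<close> \<open>y \<in> S\<close> \<delta>
      by (intro convexD) auto
    then have "\<psi> (x + \<delta> *\<^sub>R (y - x)) \<le> g (x + \<delta> *\<^sub>R (y - x))" by (rule le)
    also have "\<dots> \<le> (1 - \<delta>) * g x + \<delta> * g y"
      unfolding comb using g \<open>x \<in> S\<close> \<open>y \<in> S\<close> \<delta> by (simp add: convex_on_def)
    finally have "\<psi> (x + \<delta> *\<^sub>R (y - x)) - \<psi> x \<le> (g y - g x) * \<delta>"
      using eq by (simp add: algebra_simps)
    with \<delta> show "(\<psi> (x + \<delta> *\<^sub>R (y - x)) - \<psi> x) / \<delta> \<le> g y - g x"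
      by (simp add: pos_divide_le_eq)
  qed
  with d have "d \<le> g y - g x" by (rule tendsto_upperbound) simp
  with \<open>d \<ge> 0\<close> show ?thesis by simp
qed

section \<open>Minima of convex functions\<close>

lemma finite_stationary_values_active_convex:
  fixes g :: "'i \<Rightarrow> 'a::real_normed_vector \<Rightarrow> real"
  assumes "finite I" and g: "\<And>i. i \<in> I \<Longrightarrow> convex_on X (g i)"
    and le: "\<And>i x. i \<in> I \<Longrightarrow> x \<in> X \<Longrightarrow> \<psi> x \<le> g i x"
    and active: "\<And>x. x \<in> X \<Longrightarrow> \<exists>i\<in>I. \<psi> x = g i x"
  shows "finite (\<psi> ` d_stationary_points \<psi> X)"
proof (rule finite_image_if_finite_cover[where I = I and C = "\<lambda>i. {x \<in> X. \<psi> x = g i x}"])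
  show "d_stationary_points \<psi> X \<subseteq> (\<Union>i\<in>I. {x \<in> X. \<psi> x = g i x})"
    using active d_stationary_points_subset by fastforce
next
  fix i x y
  assume i: "i \<in> I" and x: "x \<in> d_stationary_points \<psi> X \<inter> {x \<in> X. \<psi> x = g i x}"
    and y: "y \<in> d_stationary_points \<psi> X \<inter> {x \<in> X. \<psi> x = g i x}"
  have "g i u \<le> g i v" if "u \<in> d_stationary_points \<psi> X" "\<psi> u = g i u" "u \<in> X" "v \<in> X" for u v
    using stationary_le_convex_majorant[OF that(1) that(4) g[OF i]] that le[OF i] by blast
  from this[of x y] this[of y x] x y show "\<psi> x = \<psi> y" by auto
qed (fact \<open>finite I\<close>)

lemma finite_stationary_values_convex_minus_Max_concave:
  fixes \<psi> :: "'a::real_normed_vector \<Rightarrow> real"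
  assumes "finite I" "I \<noteq> {}"
    and f: "convex_on X f" and h: "\<And>i. i \<in> I \<Longrightarrow> concave_on X (h i)"
    and \<psi>: "\<And>x. x \<in> X \<Longrightarrow> \<psi> x = f x - (MAX i\<in>I. h i x)"
  shows "finite (\<psi> ` d_stationary_points \<psi> X)"
proof (rule finite_stationary_values_active_convex[OF \<open>finite I\<close>])
  show "convex_on X (\<lambda>x. f x - h i x)" if "i \<in> I" for i
    using f h[OF that] by (rule convex_on_diff)
  show "\<psi> x \<le> f x - h i x" if "i \<in> I" "x \<in> X" for i x
    using that \<open>finite I\<close> by (simp add: \<psi>)
  show "\<exists>i\<in>I. \<psi> x = f x - h i x" if "x \<in> X" for x
  proof -
    have "(MAX i\<in>I. h i x) \<in> (\<lambda>i. h i x) ` I"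
      using \<open>finite I\<close> \<open>I \<noteq> {}\<close> by (intro Max_in) auto
    then show ?thesis using \<psi>[OF that] by auto
  qed
qed

section \<open>Convex plus piecewise affine functions\<close>

text \<open>
  The fibres of this map are the cells. Since both \<open>(f, g)\<close> and \<open>(g, f)\<close> are recorded, the
  pattern also tells which pieces coincide at \<open>x\<close>.
\<close>

definition order_pattern :: "('a \<Rightarrow> real) set \<Rightarrow> 'a \<Rightarrow> (('a \<Rightarrow> real) \<times> ('a \<Rightarrow> real)) set" where
  "order_pattern F x = {(f, g) \<in> F \<times> F. f x \<le> g x}"

lemma affine_function_combination:
  assumes "affine_function f" and "u + v = 1"
  shows "f (u *\<^sub>R x + v *\<^sub>R y) = u * f x + v * f y"
proof -
  obtain a c where f: "\<And>x. f x = a \<bullet> x + c"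
    using assms(1) unfolding affine_function_def by blast
  have "c = (u + v) * c" using assms(2) by simp
  then show ?thesis by (simp add: f inner_add_right algebra_simps)
qed

lemma affine_function_convex_on: "affine_function f \<Longrightarrow> convex S \<Longrightarrow> convex_on S f"
  by (simp add: convex_on_def affine_function_combination)

lemma affine_function_continuous_on: "affine_function f \<Longrightarrow> continuous_on S f"
proof -
  assume "affine_function f"
  then obtain a c where "f = (\<lambda>x. a \<bullet> x + c)" unfolding affine_function_def by blast
  then show ?thesis by (auto intro!: continuous_intros)
qed

text \<open>
  A cell is cut out by conditions \<open>f \<le> g\<close> and \<open>f > g\<close> on affine functions, that is, by
  closed and open half-spaces.
\<close>

lemma convex_order_cell:
  assumes F: "\<And>f. f \<in> F \<Longrightarrow> affine_function f"
  shows "convex {x. order_pattern F x = s}"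
proof (rule convexI)
  fix x y and u v :: real
  assume x: "x \<in> {x. order_pattern F x = s}" and y: "y \<in> {x. order_pattern F x = s}"
    and uv: "0 \<le> u" "0 \<le> v" "u + v = 1"
  let ?z = "u *\<^sub>R x + v *\<^sub>R y"
  have "f ?z \<le> g ?z \<longleftrightarrow> f x \<le> g x" if fg: "f \<in> F" "g \<in> F" for f g
  proof -
    have z: "f ?z = u * f x + v * f y" "g ?z = u * g x + v * g y"
      using fg F uv by (simp_all add: affine_function_combination)
    have "(f, g) \<in> order_pattern F x \<longleftrightarrow> (f, g) \<in> order_pattern F y"
      using x y by simp
    then have same: "f x \<le> g x \<longleftrightarrow> f y \<le> g y"
      using fg by (simp add: order_pattern_def)
    show ?thesis
    proof (cases "f x \<le> g x")
      case True
      with same uv have "u * f x \<le> u * g x" "v * f y \<le> v * g y"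
        by (auto intro: mult_left_mono)
      with True show ?thesis by (simp add: z)
    next
      case False
      with same have less: "g x < f x" "g y < f y" by auto
      have "g ?z < f ?z"
      proof (cases "u = 0")
        case True
        with uv less show ?thesis by (simp add: z)
      next
        case False
        with uv less have "u * g x < u * f x" by simp
        moreover from uv less have "v * g y \<le> v * f y" by (simp add: mult_left_mono)
        ultimately show ?thesis by (simp add: z)
      qed
      with False show ?thesis by simp
    qed
  qed
  then have "order_pattern F ?z = order_pattern F x"
    by (auto simp: order_pattern_def)
  with x show "?z \<in> {x. order_pattern F x = s}" by simp
qed

lemma order_pattern_eq_iff:
  assumes "order_pattern F x = order_pattern F y" "f \<in> F" "g \<in> F"
  shows "f x = g x \<longleftrightarrow> f y = g y"
proof -
  have "(f, g) \<in> order_pattern F x \<longleftrightarrow> (f, g) \<in> order_pattern F y"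
    "(g, f) \<in> order_pattern F x \<longleftrightarrow> (g, f) \<in> order_pattern F y"
    using assms(1) by simp_all
  with assms(2,3) show ?thesis by (auto simp: order_pattern_def)
qed

text \<open>
  Within a cell, the set where the selection equals the piece \<open>f\<close> is closed, and so is its
  complement: there the selection equals one of the finitely many pieces that differ from \<open>f\<close>
  throughout the cell. The cell is connected, so one of the two sets is empty.
\<close>

lemma continuous_selection_on_order_cell:
  assumes "finite F" and F: "\<And>f. f \<in> F \<Longrightarrow> affine_function f"
    and h: "continuous_on UNIV h" and sel: "\<And>x. h x \<in> (\<lambda>f. f x) ` F"
  shows "\<exists>f\<in>F. \<forall>y. order_pattern F y = order_pattern F x \<longrightarrow> h y = f y"
proof -
  define C where "C = {y. order_pattern F y = order_pattern F x}"
  obtain f where f: "f \<in> F" "h x = f x" using sel[of x] by blast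
  have closed: "closedin (top_of_set C) {y \<in> C. h y = g y}" if "g \<in> F" for g
  proof -
    have "closed {y. h y = g y}"
      using h affine_function_continuous_on[OF F[OF that]] by (intro closed_Collect_eq) auto
    then have "closedin (top_of_set C) (C \<inter> {y. h y = g y})"
      by (rule closedin_closed_Int)
    then show ?thesis by (simp add: Int_def)
  qed
  let ?T = "{y \<in> C. h y = f y}"
  have "C - ?T = (\<Union>g\<in>{g \<in> F. g x \<noteq> f x}. {y \<in> C. h y = g y})"
  proof (intro equalityI subsetI)
    fix y
    assume y: "y \<in> C - ?T"
    obtain g where g: "g \<in> F" "h y = g y" using sel[of y] by blast
    with y f order_pattern_eq_iff[of F y x g f] have "g x \<noteq> f x"
      by (auto simp: C_def)
    with g y show "y \<in> (\<Union>g\<in>{g \<in> F. g x \<noteq> f x}. {y \<in> C. h y = g y})" by blast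
  next
    fix y
    assume "y \<in> (\<Union>g\<in>{g \<in> F. g x \<noteq> f x}. {y \<in> C. h y = g y})"
    then obtain g where g: "g \<in> F" "g x \<noteq> f x" "y \<in> C" "h y = g y" by blast
    with f order_pattern_eq_iff[of F y x g f] have "g y \<noteq> f y"
      by (auto simp: C_def)
    with g show "y \<in> C - ?T" by auto
  qed
  also have "closedin (top_of_set C) \<dots>"
    using \<open>finite F\<close> closed by (intro closedin_Union) auto
  finally have "closedin (top_of_set C) (C - ?T)" .
  then have "openin (top_of_set C) ?T"
    by (auto simp: openin_closedin_eq)
  moreover have "connected C"
    unfolding C_def by (intro convex_connected convex_order_cell F)
  moreover have "x \<in> ?T" using f by (simp add: C_def)
  ultimately have "?T = C"
    using closed[OF f(1)] connected_clopen by blast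
  with f(1) show ?thesis unfolding C_def by blast
qed

lemma finite_stationary_values_convex_plus_piecewise_affine:
  assumes f: "convex_on X f" and h: "piecewise_affine h"
    and \<psi>: "\<And>x. x \<in> X \<Longrightarrow> \<psi> x = f x + h x"
  shows "finite (\<psi> ` d_stationary_points \<psi> X)"
proof -
  obtain F where "finite F" and F: "\<And>g. g \<in> F \<Longrightarrow> affine_function g"
    and sel: "\<And>x. h x \<in> (\<lambda>g. g x) ` F" and h: "continuous_on UNIV h"
    using h unfolding piecewise_affine_def by blast
  show ?thesis
  proof (rule finite_image_if_finite_cover[where I = "Pow (F \<times> F)"
        and C = "\<lambda>s. {x. order_pattern F x = s}"])
    show "finite (Pow (F \<times> F))" using \<open>finite F\<close> by simp
    show "d_stationary_points \<psi> X \<subseteq> (\<Union>s\<in>Pow (F \<times> F). {x. order_pattern F x = s})"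
      by (auto simp: order_pattern_def)
  next
    fix s x y
    assume x: "x \<in> d_stationary_points \<psi> X \<inter> {x. order_pattern F x = s}"
      and y: "y \<in> d_stationary_points \<psi> X \<inter> {x. order_pattern F x = s}"
    define C where "C = X \<inter> {x. order_pattern F x = s}"
    have xy: "x \<in> X" "y \<in> X" using x y d_stationary_points_subset by blast+
    then have xyC: "x \<in> C" "y \<in> C" using x y by (auto simp: C_def)
    obtain g where g: "g \<in> F" and hg: "\<And>z. z \<in> C \<Longrightarrow> h z = g z"
      using continuous_selection_on_order_cell[OF \<open>finite F\<close> F h sel, of x] x
      by (auto simp: C_def)
    have "convex C"
      unfolding C_def by (intro convex_Int convex_on_imp_convex[OF f] convex_order_cell F)
    then have conv: "convex_on C (\<lambda>z. f z + g z)"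
      using f g F by (intro convex_on_add convex_on_subset[OF f] affine_function_convex_on)
        (auto simp: C_def)
    have eq: "\<psi> z = f z + g z" if "z \<in> C" for z
      using that hg \<psi> by (simp add: C_def)
    have "\<psi> u \<le> \<psi> v" if "u \<in> d_stationary_points \<psi> X" "u \<in> C" "v \<in> C" for u v
      using stationary_le_convex_majorant[OF that(1) _ conv that(2,3)] that eq
      by (auto simp: C_def)
    from this[of x y] this[of y x] x y xyC show "\<psi> x = \<psi> y" by auto
  qed
qed

section \<open>Piecewise linear-quadratic functions\<close>

lemma quadratic_function_along_line:
  assumes "quadratic_function q"
  obtains a b where "\<And>t. q (x + t *\<^sub>R v) = q x + b * t + a * t\<^sup>2"
proof -
  obtain Q w c where q: "\<And>x. q x = x \<bullet> (Q *v x) + w \<bullet> x + c"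
    using assms unfolding quadratic_function_def by blast
  have "q (x + t *\<^sub>R v) = q x + (x \<bullet> (Q *v v) + v \<bullet> (Q *v x) + w \<bullet> v) * t + (v \<bullet> (Q *v v)) * t\<^sup>2"
    for t
    by (simp add: q matrix_vector_right_distrib matrix_vector_mult_scaleR inner_add_left
        inner_add_right power2_eq_square algebra_simps)
  then show ?thesis by (rule that)
qed

lemma stationary_slope_nonneg:
  assumes x: "x \<in> d_stationary_points \<psi> X" and v: "x + v \<in> X"
    and \<psi>: "\<And>t. 0 \<le> t \<Longrightarrow> t \<le> 1 \<Longrightarrow> \<psi> (x + t *\<^sub>R v) = c + b * t + a * t\<^sup>2"
  shows "b \<ge> 0"
proof -
  obtain d where "d \<ge> 0"
    and d: "((\<lambda>\<delta>. (\<psi> (x + \<delta> *\<^sub>R v) - \<psi> x) / \<delta>) \<longlongrightarrow> d) (at_right 0)"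
    using d_stationary_points_dest[OF x v] by auto
  have "((\<lambda>\<delta>. b + a * \<delta>) \<longlongrightarrow> b + a * 0) (at_right 0)"
    by (intro tendsto_intros)
  then have "((\<lambda>\<delta>. b + a * \<delta>) \<longlongrightarrow> b) (at_right 0)" by simp
  then have "((\<lambda>\<delta>. (\<psi> (x + \<delta> *\<^sub>R v) - \<psi> x) / \<delta>) \<longlongrightarrow> b) (at_right 0)"
  proof (rule Lim_transform_eventually)
    have "b + a * \<delta> = (\<psi> (x + \<delta> *\<^sub>R v) - \<psi> x) / \<delta>" if "0 < \<delta> \<and> \<delta> \<le> 1" for \<delta>
      using \<psi>[of 0] \<psi>[of \<delta>] that by (simp add: field_simps power2_eq_square)
    then show "\<forall>\<^sub>F \<delta> in at_right 0. b + a * \<delta> = (\<psi> (x + \<delta> *\<^sub>R v) - \<psi> x) / \<delta>"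
      using eventually_at_right_0_le_1 by (rule eventually_mono[rotated])
  qed
  with d have "d = b" by (intro tendsto_unique) auto
  with \<open>d \<ge> 0\<close> show ?thesis by simp
qed

text \<open>
  A point of the relative interior of \<open>F\<close> can be left inside \<open>F\<close> towards \<open>y\<close> and away
  from \<open>y\<close>. Stationarity in these two opposite directions forces the slope to vanish.
\<close>

lemma stationary_slope_zero_rel_interior:
  fixes \<psi> :: "'a::euclidean_space \<Rightarrow> real"
  assumes x: "x \<in> d_stationary_points \<psi> X" and "convex F" "F \<subseteq> X"
    and xF: "x \<in> rel_interior F" and y: "y \<in> F"
    and \<psi>: "\<And>t. x + t *\<^sub>R (y - x) \<in> F \<Longrightarrow> \<psi> (x + t *\<^sub>R (y - x)) = c + b * t + a * t\<^sup>2"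
  shows "b = 0"
proof -
  have "x \<in> F" using xF rel_interior_subset by blast
  have slope: "s * b \<ge> 0" if s: "x + s *\<^sub>R (y - x) \<in> F" for s
  proof -
    have "\<psi> (x + t *\<^sub>R (s *\<^sub>R (y - x))) = c + (s * b) * t + (s\<^sup>2 * a) * t\<^sup>2"
      if t: "0 \<le> t" "t \<le> 1" for t
    proof -
      have "x + (t * s) *\<^sub>R (y - x) = (1 - t) *\<^sub>R x + t *\<^sub>R (x + s *\<^sub>R (y - x))"
        by (simp add: algebra_simps)
      also have "\<dots> \<in> F"
        using \<open>convex F\<close> \<open>x \<in> F\<close> s t by (intro convexD) auto
      finally show ?thesis
        using \<psi>[of "t * s"] by (simp add: algebra_simps power_mult_distrib)
    qed
    then show ?thesis
      using stationary_slope_nonneg[OF x, of "s *\<^sub>R (y - x)"] s \<open>F \<subseteq> X\<close> by blast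
  qed
  obtain e where e: "e > 1" "(1 - e) *\<^sub>R y + e *\<^sub>R x \<in> F"
    using convex_rel_interior_if2[OF \<open>convex F\<close> xF] y hull_inc by metis
  have "(1 - e) *\<^sub>R y + e *\<^sub>R x = x + (1 - e) *\<^sub>R (y - x)"
    by (simp add: algebra_simps)
  with e slope[of "1 - e"] have "b \<le> 0" by (simp add: zero_le_mult_iff)
  moreover from slope[of 1] y have "b \<ge> 0" by simp
  ultimately show ?thesis by simp
qed

text \<open>
  Along the line from \<open>x\<close> to \<open>y\<close> the function is a parabola with slope \<open>b\<close> at \<open>x\<close> and
  \<open>b + 2 * a\<close> at \<open>y\<close>. Since both slopes vanish, so do its nonconstant coefficients, whatever
  the sign of the curvature \<open>a\<close>.
\<close>

lemma stationary_value_unique_rel_interior: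
  fixes \<psi> :: "real ^ 'n \<Rightarrow> real"
  assumes x: "x \<in> d_stationary_points \<psi> X" "x \<in> rel_interior F"
    and y: "y \<in> d_stationary_points \<psi> X" "y \<in> rel_interior F"
    and "convex F" "F \<subseteq> X" and q: "quadratic_function q" "\<And>z. z \<in> F \<Longrightarrow> \<psi> z = q z"
  shows "\<psi> x = \<psi> y"
proof -
  have xyF: "x \<in> F" "y \<in> F" using x y rel_interior_subset by blast+
  obtain a b where ab: "\<And>t. q (x + t *\<^sub>R (y - x)) = q x + b * t + a * t\<^sup>2"
    using quadratic_function_along_line[OF q(1), of x "y - x"] by blast
  have "b = 0"
    using stationary_slope_zero_rel_interior[OF x(1) \<open>convex F\<close> \<open>F \<subseteq> X\<close> x(2) xyF(2)] q(2) ab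
    by metis
  moreover have "- (b + 2 * a) = 0"
  proof (rule stationary_slope_zero_rel_interior[OF y(1) \<open>convex F\<close> \<open>F \<subseteq> X\<close> y(2) xyF(1)])
    fix t
    assume "y + t *\<^sub>R (x - y) \<in> F"
    (* the same parabola, reparametrized to start at y and run towards x *)
    moreover have "y + t *\<^sub>R (x - y) = x + (1 - t) *\<^sub>R (y - x)"
      by (simp add: algebra_simps)
    ultimately have "\<psi> (y + t *\<^sub>R (x - y)) = q x + b * (1 - t) + a * (1 - t)\<^sup>2"
      using q(2) ab by metis
    then show "\<psi> (y + t *\<^sub>R (x - y)) = (q x + b + a) + - (b + 2 * a) * t + a * t\<^sup>2"
      by (simp add: algebra_simps power2_eq_square)
  qed
  ultimately have "q y = q x" using ab[of 1] by simp
  with q(2) xyF show ?thesis by simp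
qed

text \<open>
  A smallest face containing the point does it: outside the relative interior of that face, the
  point would lie on one of the facets of the face, a smaller face.
\<close>

lemma polyhedron_point_in_rel_interior_face:
  fixes P :: "'a::euclidean_space set"
  assumes "polyhedron P" "x \<in> P"
  shows "\<exists>F. F face_of P \<and> x \<in> rel_interior F"
proof -
  let ?A = "{F. F face_of P \<and> x \<in> F}"
  have "finite ?A" using finite_polyhedron_faces[OF assms(1)] by (rule rev_finite_subset) auto
  moreover have "P \<in> ?A"
    using assms polyhedron_imp_convex face_of_refl by auto
  ultimately obtain F where F: "F \<in> ?A" and min: "\<And>G. G \<in> ?A \<Longrightarrow> G \<subseteq> F \<Longrightarrow> G = F"
    using finite_has_minimal[of ?A] by blast
  have "x \<in> rel_interior F"
  proof (rule ccontr)
    assume "x \<notin> rel_interior F"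
    moreover have "polyhedron F" using face_of_polyhedron_polyhedron assms(1) F by blast
    ultimately obtain G where G: "G facet_of F" "x \<in> G"
      using rel_interior_of_polyhedron[of F] F by auto
    then have "G face_of P" using F facet_of_imp_face_of face_of_trans by blast
    with G min[of G] have "G = F" using facet_of_imp_subset by blast
    with G(1) show False by simp
  qed
  with F show ?thesis by blast
qed

lemma finite_stationary_values_piecewise_linear_quadratic:
  assumes "piecewise_linear_quadratic_on X \<psi>"
  shows "finite (\<psi> ` d_stationary_points \<psi> X)"
proof -
  obtain \<P> where "finite \<P>" and X: "X = \<Union>\<P>" and poly: "\<And>P. P \<in> \<P> \<Longrightarrow> polyhedron P"
    and quad: "\<And>P. P \<in> \<P> \<Longrightarrow> \<exists>q. quadratic_function q \<and> (\<forall>x\<in>P. \<psi> x = q x)"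
    using assms unfolding piecewise_linear_quadratic_on_def by blast
  show ?thesis
  proof (rule finite_image_if_finite_cover[where I = "\<Union>P\<in>\<P>. {F. F face_of P}"
        and C = rel_interior])
    show "finite (\<Union>P\<in>\<P>. {F. F face_of P})"
      using \<open>finite \<P>\<close> poly finite_polyhedron_faces by blast
    show "d_stationary_points \<psi> X \<subseteq> (\<Union>F\<in>(\<Union>P\<in>\<P>. {F. F face_of P}). rel_interior F)"
    proof
      fix x
      assume "x \<in> d_stationary_points \<psi> X"
      then obtain P where "P \<in> \<P>" "x \<in> P" using d_stationary_points_subset X by blast
      with polyhedron_point_in_rel_interior_face[OF poly]
      show "x \<in> (\<Union>F\<in>(\<Union>P\<in>\<P>. {F. F face_of P}). rel_interior F)" by blast
    qed
  next
    fix F x y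
    assume "F \<in> (\<Union>P\<in>\<P>. {F. F face_of P})"
      and x: "x \<in> d_stationary_points \<psi> X \<inter> rel_interior F"
      and y: "y \<in> d_stationary_points \<psi> X \<inter> rel_interior F"
    then obtain P where P: "P \<in> \<P>" "F face_of P" by blast
    then have "convex F" "F \<subseteq> P" using face_of_imp_convex face_of_imp_subset by blast+
    moreover obtain q where "quadratic_function q" "\<forall>x\<in>P. \<psi> x = q x"
      using quad[OF P(1)] by blast
    ultimately show "\<psi> x = \<psi> y"
      using stationary_value_unique_rel_interior[of x \<psi> X F y q] x y X P(1) by blast
  qed
qed

section \<open>The three classes together\<close>

theorem proposition2:
  fixes X :: "(real ^ 'n) set" and \<psi> :: "real ^ 'n \<Rightarrow> real"
  assumes "polyhedron X"
    and "piecewise_linear_quadratic_on X \<psi> \<or>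
      (\<exists>\<Omega> \<psi>\<^sub>1 (\<psi>\<^sub>2 :: nat \<Rightarrow> real ^ 'n \<Rightarrow> real) k\<^sub>2.
         open \<Omega> \<and> convex \<Omega> \<and> X \<subseteq> \<Omega> \<and> k\<^sub>2 \<ge> 1 \<and>
         convex_on \<Omega> \<psi>\<^sub>1 \<and> (\<forall>i\<in>{1..k\<^sub>2}. concave_on \<Omega> (\<psi>\<^sub>2 i)) \<and>
         (\<forall>x\<in>\<Omega>. \<psi> x = \<psi>\<^sub>1 x - (MAX i\<in>{1..k\<^sub>2}. \<psi>\<^sub>2 i x))) \<or>
      (\<exists>\<Omega> \<psi>\<^sub>1 \<psi>\<^sub>2.
         open \<Omega> \<and> convex \<Omega> \<and> X \<subseteq> \<Omega> \<and>
         convex_on \<Omega> \<psi>\<^sub>1 \<and> piecewise_affine \<psi>\<^sub>2 \<and>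
         (\<forall>x\<in>\<Omega>. \<psi> x = \<psi>\<^sub>1 x + \<psi>\<^sub>2 x))"
  shows "finite (\<psi> ` d_stationary_points \<psi> X)"
  using assms(2)
proof (elim disjE exE conjE)
  assume "piecewise_linear_quadratic_on X \<psi>"
  then show ?thesis by (rule finite_stationary_values_piecewise_linear_quadratic)
next
  fix \<Omega> \<psi>\<^sub>1 k\<^sub>2 and \<psi>\<^sub>2 :: "nat \<Rightarrow> real ^ 'n \<Rightarrow> real"
  assume "X \<subseteq> \<Omega>" "k\<^sub>2 \<ge> 1" "convex_on \<Omega> \<psi>\<^sub>1" "\<forall>i\<in>{1..k\<^sub>2}. concave_on \<Omega> (\<psi>\<^sub>2 i)"
    "\<forall>x\<in>\<Omega>. \<psi> x = \<psi>\<^sub>1 x - (MAX i\<in>{1..k\<^sub>2}. \<psi>\<^sub>2 i x)"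
  with polyhedron_imp_convex[OF assms(1)] show ?thesis
    by (intro finite_stationary_values_convex_minus_Max_concave[of "{1..k\<^sub>2}" X \<psi>\<^sub>1 \<psi>\<^sub>2])
      (auto simp: concave_on_def intro: convex_on_subset)
next
  fix \<Omega> \<psi>\<^sub>1 \<psi>\<^sub>2
  assume "X \<subseteq> \<Omega>" "convex_on \<Omega> \<psi>\<^sub>1" "piecewise_affine \<psi>\<^sub>2" "\<forall>x\<in>\<Omega>. \<psi> x = \<psi>\<^sub>1 x + \<psi>\<^sub>2 x"
  with polyhedron_imp_convex[OF assms(1)] show ?thesis
    by (intro finite_stationary_values_convex_plus_piecewise_affine[of X \<psi>\<^sub>1 \<psi>\<^sub>2])
      (auto intro: convex_on_subset)
qed

end
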